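(* Let $k$ be a field with $\mathrm{char}(k)\ne 2$ and let $X\subseteq\{\sigma,\tau,\rho\}$ be a non-empty subset. Then $\phi_X$ is an abelian $3$-cocycle if and only if $\phi_X$ is even and $k$ contains a primitive fourth root of $1$.
   Context: $G=C_2\times C_2=\{e,\sigma,\tau,\rho\}$ is the Klein group, with $\sigma\tau=\tau\sigma=\rho$, $\sigma^2=\tau^2=e$. $k^*=k\setminus\{0\}$. A $3$-cocycle is a map $\phi:G^3\to k^*$ with $\phi(y,z,t)\phi(x,yz,t)\phi(x,y,z)=\phi(xy,z,t)\phi(x,y,zt)$; it is normalized if $\phi(x,e,z)=1$ for all $x,z$. A normalized $3$-cocycle $\phi$ is called abelian (by abuse of language) if there exists $\mathcal R:G\times G\to k^*$ such that for all $x,y,z\in G$: $\mathcal R(xy,z)\phi(x,z,y)=\phi(x,y,z)\mathcal R(x,z)\phi(z,x,y)\mathcal R(y,z)$ and $\phi(x,y,z)\mathcal R(x,yz)\phi(y,z,x)=\mathcal R(x,y)\phi(y,x,z)\mathcal R(x,z)$. Definition of $\phi_X$: for $x\in\{\sigma,\tau,\rho\}$ let $\varepsilon_x=-1$ if $x\in X$ and $\varepsilon_x=1$ otherwise, and $p=\varepsilon_\sigma\varepsilon_\tau\varepsilon_\rho$. Then $\phi_X:G^3\to k^*$ is the normalized $3$-cocycle, invariant under permuting its three arguments, such that $\phi_X$ is $1$ if one argument is $e$; $\phi_X(x,x,x)=\varepsilon_x$; $\phi_X(\sigma,\tau,\rho)=p$; $\phi_X(\tau,\sigma,\sigma)=1$;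 $\phi_X(\sigma,\tau,\tau)=p$; $\phi_X(\rho,\sigma,\sigma)=\varepsilon_\sigma$; $\phi_X(\sigma,\rho,\rho)=p\varepsilon_\sigma$; $\phi_X(\rho,\tau,\tau)=p\varepsilon_\tau$; $\phi_X(\tau,\rho,\rho)=\varepsilon_\tau$. $\phi_X$ is even if $p=1$ (equivalently $|X|$ is even). *)

theory Defs
  imports
    "HOL-Library.Z2"
    "HOL-Library.Product_Plus"
    "HOL-Library.Multiset"
    "HOL-Computational_Algebra.Computational_Algebra"
begin

text \<open>
  Groups are written additively, so that the library's instances for \<open>bit\<close> (the group with two
  elements) and for products provide the Klein group directly; its neutral element is \<open>0 = (0, 0)\<close>.
  Values lie in the multiplicative group of a field, written multiplicatively.
\<close>

definition three_cocycle :: "('g::group_add \<Rightarrow> 'g \<Rightarrow> 'g \<Rightarrow> 'k::field) \<Rightarrow> bool" where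
  "three_cocycle \<phi> \<longleftrightarrow>
     (\<forall>x y z. \<phi> x y z \<noteq> 0) \<and>
     (\<forall>x y z t. \<phi> y z t * \<phi> x (y + z) t * \<phi> x y z = \<phi> (x + y) z t * \<phi> x y (z + t))"

definition normalized_three_cocycle :: "('g::group_add \<Rightarrow> 'g \<Rightarrow> 'g \<Rightarrow> 'k::field) \<Rightarrow> bool" where
  "normalized_three_cocycle \<phi> \<longleftrightarrow> three_cocycle \<phi> \<and> (\<forall>x z. \<phi> x 0 z = 1)"

definition abelian_three_cocycle :: "('g::ab_group_add \<Rightarrow> 'g \<Rightarrow> 'g \<Rightarrow> 'k::field) \<Rightarrow> bool" where
  "abelian_three_cocycle \<phi> \<longleftrightarrow>
     normalized_three_cocycle \<phi> \<and>
     (\<exists>R :: 'g \<Rightarrow> 'g \<Rightarrow> 'k.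
        (\<forall>x y. R x y \<noteq> 0) \<and>
        (\<forall>x y z. R (x + y) z * \<phi> x z y = \<phi> x y z * R x z * \<phi> z x y * R y z) \<and>
        (\<forall>x y z. \<phi> x y z * R x (y + z) * \<phi> y z x = R x y * \<phi> y x z * R x z))"

type_synonym klein = "bit \<times> bit"

abbreviation klein_sigma :: klein ("\<sigma>") where "\<sigma> \<equiv> (1, 0)"
abbreviation klein_tau :: klein ("\<tau>") where "\<tau> \<equiv> (0, 1)"
abbreviation klein_rho :: klein ("\<rho>") where "\<rho> \<equiv> (1, 1)"

definition eps :: "klein set \<Rightarrow> klein \<Rightarrow> 'k::field" where
  "eps X x = (if x \<in> X then - 1 else 1)"

definition eps_prod :: "klein set \<Rightarrow> 'k::field" where
  "eps_prod X = eps X \<sigma> * eps X \<tau> * eps X \<rho>"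

text \<open>
  The value depends only on the multiset of the three arguments, which builds in the invariance
  under permutations. The final branch is reached only for \<open>{#\<tau>, \<rho>, \<rho>#}\<close>.
\<close>

definition phi_X :: "klein set \<Rightarrow> klein \<Rightarrow> klein \<Rightarrow> klein \<Rightarrow> 'k::field" where
  "phi_X X x y z =
     (let m = {#x, y, z#} in
      if 0 \<in># m then 1
      else if x = y \<and> y = z then eps X x
      else if m = {#\<sigma>, \<tau>, \<rho>#} then eps_prod X
      else if m = {#\<tau>, \<sigma>, \<sigma>#} then 1
      else if m = {#\<sigma>, \<tau>, \<tau>#} then eps_prod X
      else if m = {#\<rho>, \<sigma>, \<sigma>#} then eps X \<sigma>
      else if m = {#\<sigma>, \<rho>, \<rho>#} then eps_prod X * eps X \<sigma>
      else if m = {#\<rho>, \<tau>, \<tau>#} then eps_prod X * eps X \<tau>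
      else eps X \<tau>)"

lemma phi_X_permute:
  "phi_X X y x z = phi_X X x y z"
  "phi_X X x z y = phi_X X x y z"
  by (auto simp: phi_X_def Let_def add_mset_commute)

lemma phi_X_neutral:
  "phi_X X 0 y z = 1" "phi_X X x 0 z = 1" "phi_X X x y 0 = 1"
  by (simp_all add: phi_X_def)

lemma phi_X_values:
  "x \<noteq> 0 \<Longrightarrow> phi_X X x x x = eps X x"
  "phi_X X \<sigma> \<tau> \<rho> = eps_prod X"
  "phi_X X \<tau> \<sigma> \<sigma> = 1"
  "phi_X X \<sigma> \<tau> \<tau> = eps_prod X"
  "phi_X X \<rho> \<sigma> \<sigma> = eps X \<sigma>"
  "phi_X X \<sigma> \<rho> \<rho> = eps_prod X * eps X \<sigma>"
  "phi_X X \<rho> \<tau> \<tau> = eps_prod X * eps X \<tau>"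
  "phi_X X \<tau> \<rho> \<rho> = eps X \<tau>"
  by (simp_all add: phi_X_def zero_prod_def add_eq_conv_ex)

definition primitive_root_of_unity :: "nat \<Rightarrow> 'k::field \<Rightarrow> bool" where
  "primitive_root_of_unity n \<omega> \<longleftrightarrow>
     0 < n \<and> \<omega> ^ n = 1 \<and> (\<forall>m. 0 < m \<and> m < n \<longrightarrow> \<omega> ^ m \<noteq> 1)"

end

theory Submission
  imports Defs
begin

text \<open>
  When \<open>\<phi>\<close> is symmetric in its arguments, the two hexagon conditions become
  \<open>R (x + y) z = \<phi> x y z * R x z * R y z\<close> and \<open>\<phi> x y z * R x (y + z) = R x y * R x z\<close>: up to the
  factor \<open>\<phi>\<close>, the map \<open>R\<close> is a bicharacter. In particular \<open>R 0 z = R z 0 = 1\<close>.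

  Necessity. Taking the two arguments that are added to be equal in a group of exponent two gives
  \<open>\<phi> x x y * (R x y)\<^sup>2 = 1\<close> and \<open>(R x y)\<^sup>2 = \<phi> x y y\<close>, which is lemma
  \<open>symmetric_abelian_exponent_two\<close>. At \<open>(\<sigma>, \<tau>)\<close> the product \<open>\<phi> \<sigma> \<sigma> \<tau> * \<phi> \<sigma> \<tau> \<tau>\<close> is \<open>p\<close>, so
  \<open>\<phi>\<^sub>X\<close> is even. At \<open>(x, x)\<close> with \<open>x \<in> X\<close> the second identity exhibits \<open>-1\<close> as a square, and the
  square roots of \<open>-1\<close> are the primitive fourth roots of unity.

  Sufficiency. If \<open>p = 1\<close> then \<open>\<phi>\<^sub>X\<close> splits as a product of two cocycles inflated from the
  coordinate projections to the group with two elements (lemma \<open>phi_X_even\<close>): the first one takes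
  the value \<open>\<epsilon>\<^sub>\<sigma>\<close> and the second one the value \<open>\<epsilon>\<^sub>\<tau>\<close> at the non-trivial triple. Being abelian is
  stable under inflation and products, and on the group with two elements the cocycle with value
  \<open>a\<^sup>2\<close>, where \<open>a\<^sup>4 = 1\<close>, is made abelian by \<open>R 1 1 = a\<close>. With a square root of \<open>-1\<close> at hand, both
  signs are such squares.
\<close>

section \<open>Square roots of minus one\<close>

lemma char_ne_2_imp_two_ne_zero:
  assumes "CHAR('k::field) \<noteq> 2"
  shows "(2::'k) \<noteq> 0"
proof
  assume "(2::'k) = 0"
  then have "of_nat 2 = (0::'k)"
    by simp
  then have "CHAR('k) dvd 2"
    by (simp only: of_nat_eq_0_iff_char_dvd)
  then have "CHAR('k) \<le> 2" "CHAR('k) \<noteq> 0"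
    by (auto dest: dvd_imp_le dvd_pos_nat[rotated])
  moreover have "CHAR('k) \<noteq> 1"
    by simp
  ultimately show False
    using assms by linarith
qed

text \<open>
  In odd or zero characteristic \<open>X^4 - 1 = (X\<^sup>2 - 1) * (X\<^sup>2 + 1)\<close> has coprime factors, and the first
  one collects the roots of order at most two.
\<close>
lemma primitive_fourth_root_iff:
  fixes \<omega> :: "'k::field"
  assumes "(2::'k) \<noteq> 0"
  shows "primitive_root_of_unity 4 \<omega> \<longleftrightarrow> \<omega>\<^sup>2 = - 1"
proof
  assume \<omega>: "primitive_root_of_unity 4 \<omega>"
  then have "\<omega> ^ 4 = 1" and "\<omega>\<^sup>2 \<noteq> 1"
    by (simp_all add: primitive_root_of_unity_def)
  moreover have "\<omega> ^ 4 = (\<omega>\<^sup>2)\<^sup>2"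
    by simp
  ultimately show "\<omega>\<^sup>2 = - 1"
    by (metis power2_eq_1_iff)
next
  assume \<omega>: "\<omega>\<^sup>2 = - 1"
  have ne: "(1::'k) \<noteq> - 1"
    using assms by (metis add.right_inverse one_add_one)
  have "\<omega> ^ 4 = (\<omega>\<^sup>2)\<^sup>2"
    by simp
  then have four: "\<omega> ^ 4 = 1"
    by (simp add: \<omega>)
  have one: "\<omega> \<noteq> 1"
    using \<omega> ne by auto
  have "\<omega> ^ 3 = - \<omega>"
    using \<omega> by (simp add: power3_eq_cube power2_eq_square)
  moreover have "- \<omega> \<noteq> 1"
    using \<omega> ne by (metis power2_minus power_one)
  ultimately have three: "\<omega> ^ 3 \<noteq> 1"
    by simp
  have "\<omega> ^ m \<noteq> 1" if "0 < m" "m < 4" for m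
  proof -
    have "m = 1 \<or> m = 2 \<or> m = 3"
      using that by linarith
    then show ?thesis
      using one three \<omega> ne by auto
  qed
  with four show "primitive_root_of_unity 4 \<omega>"
    by (simp add: primitive_root_of_unity_def)
qed

section \<open>The obstruction for symmetric cocycles\<close>

text \<open>
  The same value \<open>(R x y)\<^sup>2\<close> is computed by doubling the first argument of \<open>R\<close> and by doubling the
  second one; comparing the two results gives the first conclusion.
\<close>
lemma symmetric_abelian_exponent_two:
  fixes \<phi> :: "'g::ab_group_add \<Rightarrow> 'g \<Rightarrow> 'g \<Rightarrow> 'k::field"
  assumes ab: "abelian_three_cocycle \<phi>"
    and sym: "\<And>x y z. \<phi> y x z = \<phi> x y z" "\<And>x y z. \<phi> x z y = \<phi> x y z"
    and x: "x + x = 0" and y: "y + y = 0"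
  shows "\<phi> x x y * \<phi> x y y = 1" and "\<exists>r. r\<^sup>2 = \<phi> x y y"
proof -
  from ab have nz: "\<phi> u v w \<noteq> 0" and norm: "\<phi> u 0 w = 1" for u v w
    by (simp_all add: abelian_three_cocycle_def normalized_three_cocycle_def three_cocycle_def)
  from ab obtain R where R: "\<And>u v. R u v \<noteq> 0"
    and hex1: "\<And>u v w. R (u + v) w * \<phi> u w v = \<phi> u v w * R u w * \<phi> w u v * R v w"
    and hex2: "\<And>u v w. \<phi> u v w * R u (v + w) * \<phi> v w u = R u v * \<phi> v u w * R u w"
    unfolding abelian_three_cocycle_def by metis
  have add1: "R (u + v) w = \<phi> u v w * R u w * R v w" for u v w
  proof -
    have "\<phi> u w v = \<phi> u v w" "\<phi> w u v = \<phi> u v w"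
      by (metis sym)+
    then show ?thesis
      using hex1[of u v w] nz[of u v w] by (simp add: mult_ac)
  qed
  have add2: "\<phi> u v w * R u (v + w) = R u v * R u w" for u v w
  proof -
    have "\<phi> v w u = \<phi> u v w" "\<phi> v u w = \<phi> u v w"
      by (metis sym)+
    then show ?thesis
      using hex2[of u v w] nz[of u v w] by (simp add: mult_ac)
  qed
  have "\<phi> 0 0 w = 1" for w
    by (rule norm)
  then have R01: "R 0 w = 1" for w
    using add1[of 0 0 w] R[of 0 w] by simp
  have R02: "R u 0 = 1" for u
    using add2[of u 0 0] R[of u 0] by (simp add: norm)
  have "\<phi> x x y * (R x y)\<^sup>2 = 1"
    using add1[of x x y] by (simp add: x R01 power2_eq_square mult.assoc)
  moreover have sq: "(R x y)\<^sup>2 = \<phi> x y y"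
    using add2[of x y y] by (simp add: y R02 power2_eq_square)
  ultimately show "\<phi> x x y * \<phi> x y y = 1"
    by simp
  show "\<exists>r. r\<^sup>2 = \<phi> x y y"
    using sq by blast
qed

section \<open>Constructing abelian cocycles\<close>

lemma abelian_three_cocycle_inflation:
  fixes f :: "'g::ab_group_add \<Rightarrow> 'h::ab_group_add"
  assumes ab: "abelian_three_cocycle \<phi>" and f: "\<And>x y. f (x + y) = f x + f y"
  shows "abelian_three_cocycle (\<lambda>x y z. \<phi> (f x) (f y) (f z))"
proof -
  have f0: "f 0 = 0"
    using f[of 0 0] by simp
  from ab obtain R where "\<And>u v. R u v \<noteq> 0"
    and "\<And>u v w. R (u + v) w * \<phi> u w v = \<phi> u v w * R u w * \<phi> w u v * R v w"
    and "\<And>u v w. \<phi> u v w * R u (v + w) * \<phi> v w u = R u v * \<phi> v u w * R u w"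
    unfolding abelian_three_cocycle_def by metis
  then have "\<exists>R'. (\<forall>x y. R' x y \<noteq> 0) \<and>
      (\<forall>x y z. R' (x + y) z * \<phi> (f x) (f z) (f y) =
         \<phi> (f x) (f y) (f z) * R' x z * \<phi> (f z) (f x) (f y) * R' y z) \<and>
      (\<forall>x y z. \<phi> (f x) (f y) (f z) * R' x (y + z) * \<phi> (f y) (f z) (f x) =
         R' x y * \<phi> (f y) (f x) (f z) * R' x z)"
    by (intro exI[of _ "\<lambda>x y. R (f x) (f y)"]) (simp add: f)
  then show ?thesis
    using ab
    by (simp add: abelian_three_cocycle_def normalized_three_cocycle_def three_cocycle_def f f0)
qed

lemma abelian_three_cocycle_mult:
  fixes \<phi> \<psi> :: "'g::ab_group_add \<Rightarrow> 'g \<Rightarrow> 'g \<Rightarrow> 'k::field"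
  assumes \<phi>: "abelian_three_cocycle \<phi>" and \<psi>: "abelian_three_cocycle \<psi>"
  shows "abelian_three_cocycle (\<lambda>x y z. \<phi> x y z * \<psi> x y z)"
proof -
  from \<phi> have co_\<phi>: "\<phi> y z t * \<phi> x (y + z) t * \<phi> x y z = \<phi> (x + y) z t * \<phi> x y (z + t)"
    and nz_\<phi>: "\<phi> x y z \<noteq> 0" and norm_\<phi>: "\<phi> x 0 z = 1" for x y z t
    by (simp_all add: abelian_three_cocycle_def normalized_three_cocycle_def three_cocycle_def)
  from \<psi> have co_\<psi>: "\<psi> y z t * \<psi> x (y + z) t * \<psi> x y z = \<psi> (x + y) z t * \<psi> x y (z + t)"
    and nz_\<psi>: "\<psi> x y z \<noteq> 0" and norm_\<psi>: "\<psi> x 0 z = 1" for x y z t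
    by (simp_all add: abelian_three_cocycle_def normalized_three_cocycle_def three_cocycle_def)
  from \<phi> obtain R where R: "\<And>u v. R u v \<noteq> 0"
      "\<And>u v w. R (u + v) w * \<phi> u w v = \<phi> u v w * R u w * \<phi> w u v * R v w"
      "\<And>u v w. \<phi> u v w * R u (v + w) * \<phi> v w u = R u v * \<phi> v u w * R u w"
    unfolding abelian_three_cocycle_def by metis
  from \<psi> obtain S where S: "\<And>u v. S u v \<noteq> 0"
      "\<And>u v w. S (u + v) w * \<psi> u w v = \<psi> u v w * S u w * \<psi> w u v * S v w"
      "\<And>u v w. \<psi> u v w * S u (v + w) * \<psi> v w u = S u v * \<psi> v u w * S u w"
    unfolding abelian_three_cocycle_def by metis
  have pair: "a * c = b * d" if "a = b" "c = d" for a b c d :: 'k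
    using that by simp
  show ?thesis
    unfolding abelian_three_cocycle_def normalized_three_cocycle_def three_cocycle_def
  proof (intro conjI allI exI[of _ "\<lambda>x y. R x y * S x y"])
    fix x y z t
    show "\<phi> y z t * \<psi> y z t * (\<phi> x (y + z) t * \<psi> x (y + z) t) * (\<phi> x y z * \<psi> x y z) =
        \<phi> (x + y) z t * \<psi> (x + y) z t * (\<phi> x y (z + t) * \<psi> x y (z + t))"
      using pair[OF co_\<phi>[of y z t x] co_\<psi>[of y z t x]] by (simp only: mult_ac)
  next
    fix x y z
    show "R (x + y) z * S (x + y) z * (\<phi> x z y * \<psi> x z y) =
        \<phi> x y z * \<psi> x y z * (R x z * S x z) * (\<phi> z x y * \<psi> z x y) * (R y z * S y z)"
      using pair[OF R(2)[of x y z] S(2)[of x y z]] by (simp only: mult_ac)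
    show "\<phi> x y z * \<psi> x y z * (R x (y + z) * S x (y + z)) * (\<phi> y z x * \<psi> y z x) =
        R x y * S x y * (\<phi> y x z * \<psi> y x z) * (R x z * S x z)"
      using pair[OF R(3)[of x y z] S(3)[of x y z]] by (simp only: mult_ac)
  qed (simp_all add: nz_\<phi> nz_\<psi> norm_\<phi> norm_\<psi> R(1) S(1))
qed

definition bit_cocycle :: "'k::field \<Rightarrow> bit \<Rightarrow> bit \<Rightarrow> bit \<Rightarrow> 'k" where
  "bit_cocycle e x y z = (if x = 1 \<and> y = 1 \<and> z = 1 then e else 1)"

text \<open>
  The cocycle condition at the all-one quadruple reads \<open>e\<^sup>2 = 1\<close> for \<open>e = a\<^sup>2\<close>. This is where
  \<open>a ^ 4 = 1\<close> enters; the hexagon conditions at the all-one triple, where \<open>1 + 1 = 0\<close>, read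
  \<open>e = e\<^sup>2 * a\<^sup>2\<close> and \<open>e\<^sup>2 = a\<^sup>2 * e\<close>.
\<close>
lemma abelian_bit_cocycle:
  fixes a :: "'k::field"
  assumes a: "a ^ 4 = 1"
  shows "abelian_three_cocycle (bit_cocycle (a\<^sup>2))"
proof -
  have a': "a * (a * (a * a)) = 1"
    using a by (simp add: eval_nat_numeral)
  then have "a \<noteq> 0"
    by auto
  then show ?thesis
    unfolding abelian_three_cocycle_def normalized_three_cocycle_def three_cocycle_def
  proof (intro conjI allI exI[of _ "\<lambda>x y. if x = 1 \<and> y = 1 then a else 1"])
    fix x y z t :: bit
    let ?\<phi> = "bit_cocycle (a\<^sup>2)" and ?R = "\<lambda>x y :: bit. if x = 1 \<and> y = 1 then a else 1"
    show "?\<phi> y z t * ?\<phi> x (y + z) t * ?\<phi> x y z = ?\<phi> (x + y) z t * ?\<phi> x y (z + t)"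
      by (cases x; cases y; cases z; cases t)
         (simp_all add: bit_cocycle_def power2_eq_square mult.assoc a')
    show "?R (x + y) z * ?\<phi> x z y = ?\<phi> x y z * ?R x z * ?\<phi> z x y * ?R y z"
      "?\<phi> x y z * ?R x (y + z) * ?\<phi> y z x = ?R x y * ?\<phi> y x z * ?R x z"
      by (cases x; cases y; cases z;
          simp add: bit_cocycle_def power2_eq_square mult.assoc a')+
  qed (simp_all add: bit_cocycle_def)
qed

section \<open>The even cocycles on the Klein group\<close>

lemma klein_cases:
  fixes u :: klein
  obtains "u = (0, 0)" | "u = \<sigma>" | "u = \<tau>" | "u = \<rho>"
  by (metis (full_types) bit.exhaust surj_pair)

text \<open>
  Evenness eliminates \<open>\<epsilon>\<^sub>\<rho> = \<epsilon>\<^sub>\<sigma> * \<epsilon>\<^sub>\<tau>\<close>, and what remains of the table depends on the two coordinates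
  separately: \<open>\<sigma>\<close> and \<open>\<rho>\<close> have first coordinate \<open>1\<close>, while \<open>\<tau>\<close> and \<open>\<rho>\<close> have second coordinate \<open>1\<close>.
\<close>
lemma phi_X_even:
  assumes even: "eps_prod X = (1::'k::field)"
  shows "phi_X X x y z =
    bit_cocycle (eps X \<sigma> :: 'k) (fst x) (fst y) (fst z) * bit_cocycle (eps X \<tau>) (snd x) (snd y) (snd z)"
proof -
  have sq: "eps X u * eps X u = (1::'k)" for u
    by (simp add: eps_def)
  have "(eps X \<sigma> * eps X \<tau>) * (eps X \<sigma> * eps X \<tau> * eps X \<rho>) = (eps X \<sigma> * eps X \<tau> :: 'k)"
    using even by (simp add: eps_prod_def)
  then have rho: "eps X \<rho> = (eps X \<sigma> * eps X \<tau> :: 'k)"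
    by (metis (no_types, lifting) mult.assoc mult.commute mult_1 sq)
  have distinct: "phi_X X \<sigma> \<tau> \<rho> = (1::'k)"
    by (simp only: phi_X_values even)
  have repeated: "phi_X X \<tau> \<sigma> \<sigma> = (1::'k)" "phi_X X \<sigma> \<tau> \<tau> = (1::'k)"
      "phi_X X \<rho> \<sigma> \<sigma> = (eps X \<sigma> :: 'k)" "phi_X X \<sigma> \<rho> \<rho> = (eps X \<sigma> :: 'k)"
      "phi_X X \<rho> \<tau> \<tau> = (eps X \<tau> :: 'k)" "phi_X X \<tau> \<rho> \<rho> = (eps X \<tau> :: 'k)"
    by (simp_all only: phi_X_values even mult_1)
  have diag: "phi_X X \<sigma> \<sigma> \<sigma> = (eps X \<sigma> :: 'k)" "phi_X X \<tau> \<tau> \<tau> = (eps X \<tau> :: 'k)"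
      "phi_X X \<rho> \<rho> \<rho> = (eps X \<sigma> * eps X \<tau> :: 'k)"
    by (simp_all add: phi_X_values(1) zero_prod_def rho)
  note swap1 = trans[OF phi_X_permute(1)] and swap2 = trans[OF phi_X_permute(2)]
  \<comment> \<open>Six arrangements of the distinct triple, three of each triple with one repetition.\<close>
  note table = distinct distinct[THEN swap1] distinct[THEN swap2]
    distinct[THEN swap1, THEN swap2] distinct[THEN swap2, THEN swap1]
    distinct[THEN swap1, THEN swap2, THEN swap1]
    repeated repeated[THEN swap1] repeated[THEN swap1, THEN swap2]
    diag phi_X_neutral[unfolded zero_prod_def]
  show ?thesis
    by (cases x rule: klein_cases; cases y rule: klein_cases; cases z rule: klein_cases)
       (simp_all add: table bit_cocycle_def)
qed

section \<open>The abelian cocycles on the Klein group\<close>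

theorem proposition4p4:
  fixes X :: "klein set"
  assumes char: "CHAR('k::field) \<noteq> 2"
    and X_sub: "X \<subseteq> {\<sigma>, \<tau>, \<rho>}"
    and X_nonempty: "X \<noteq> {}"
  shows "abelian_three_cocycle (phi_X X :: klein \<Rightarrow> klein \<Rightarrow> klein \<Rightarrow> 'k) \<longleftrightarrow>
    (eps_prod X :: 'k) = 1 \<and> (\<exists>\<omega>::'k. primitive_root_of_unity 4 \<omega>)"
proof -
  have two: "(2::'k) \<noteq> 0"
    using char by (rule char_ne_2_imp_two_ne_zero)
  show ?thesis
  proof
    assume ab: "abelian_three_cocycle (phi_X X :: klein \<Rightarrow> klein \<Rightarrow> klein \<Rightarrow> 'k)"
    have exp2: "u + u = 0" for u :: klein
      by (cases u) (simp add: zero_prod_def)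
    note obstruction = symmetric_abelian_exponent_two[OF ab phi_X_permute exp2 exp2]
    have "phi_X X \<sigma> \<sigma> \<tau> = (phi_X X \<tau> \<sigma> \<sigma> :: 'k)"
      by (metis phi_X_permute)
    then have "eps_prod X = (1::'k)"
      using obstruction(1)[of \<sigma> \<tau>] by (simp add: phi_X_values)
    moreover obtain x where "x \<in> X"
      using X_nonempty by blast
    then have "phi_X X x x x = (- 1 :: 'k)"
      using X_sub by (subst phi_X_values(1)) (auto simp: eps_def zero_prod_def)
    then have "\<exists>\<omega>::'k. primitive_root_of_unity 4 \<omega>"
      using obstruction(2)[of x x] by (simp add: primitive_fourth_root_iff[OF two])
    ultimately show "(eps_prod X :: 'k) = 1 \<and> (\<exists>\<omega>::'k. primitive_root_of_unity 4 \<omega>)"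
      by blast
  next
    assume "(eps_prod X :: 'k) = 1 \<and> (\<exists>\<omega>::'k. primitive_root_of_unity 4 \<omega>)"
    then obtain \<omega> :: 'k where even: "eps_prod X = (1::'k)" and \<omega>: "\<omega>\<^sup>2 = - 1"
      by (auto simp: primitive_fourth_root_iff[OF two])
    have "abelian_three_cocycle (bit_cocycle (eps X u :: 'k))" for u
    proof -
      define a where "a = (if u \<in> X then \<omega> else 1)"
      have sq: "a\<^sup>2 = eps X u"
        by (simp add: a_def eps_def \<omega>)
      have "a ^ 4 = (a\<^sup>2)\<^sup>2"
        by simp
      also have "\<dots> = 1"
        unfolding sq by (simp add: eps_def)
      finally show ?thesis
        using abelian_bit_cocycle[of a] by (simp add: sq)
    qed
    then have "abelian_three_cocycle (\<lambda>x y z :: klein.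
        bit_cocycle (eps X \<sigma> :: 'k) (fst x) (fst y) (fst z) *
        bit_cocycle (eps X \<tau>) (snd x) (snd y) (snd z))"
      by (intro abelian_three_cocycle_mult abelian_three_cocycle_inflation[where f = fst]
          abelian_three_cocycle_inflation[where f = snd]) simp_all
    then show "abelian_three_cocycle (phi_X X :: klein \<Rightarrow> klein \<Rightarrow> klein \<Rightarrow> 'k)"
      unfolding phi_X_even[OF even, abs_def] .
  qed
qed

end
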